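(* Let $\mu(n)=\frac{\pi}{6}\sqrt{24n-1}$. For an integer $n$, set $x=\mu(n-1)$, $y=\mu(n)$, $z=\mu(n+1)$ and define $$f(n)=e^{x-2y+z}\,\frac{(x^{10}-x^9-1)\,y^{24}\,(z^{10}-z^9-1)}{x^{12}\,(y^{10}-y^9+1)^2\,z^{12}},\qquad g(n)=e^{x-2y+z}\,\frac{(x^{10}-x^9+1)\,y^{24}\,(z^{10}-z^9+1)}{x^{12}\,(y^{10}-y^9-1)^2\,z^{12}}.$$ Then for all integers $n\geq 2$, $$g(n+1)<f(n)+\frac{110}{\mu(n-1)^5}.$$ *)

theory Defs
  imports Complex_Main
begin

definition mu :: "int \<Rightarrow> real" where
  "mu n = pi / 6 * sqrt (24 * real_of_int n - 1)"

definition f :: "int \<Rightarrow> real" where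
  "f n = (let x = mu (n - 1); y = mu n; z = mu (n + 1) in
     exp (x - 2 * y + z) *
       (((x ^ 10 - x ^ 9 - 1) * y ^ 24 * (z ^ 10 - z ^ 9 - 1)) /
        (x ^ 12 * (y ^ 10 - y ^ 9 + 1) ^ 2 * z ^ 12)))"

definition g :: "int \<Rightarrow> real" where
  "g n = (let x = mu (n - 1); y = mu n; z = mu (n + 1) in
     exp (x - 2 * y + z) *
       (((x ^ 10 - x ^ 9 + 1) * y ^ 24 * (z ^ 10 - z ^ 9 + 1)) /
        (x ^ 12 * (y ^ 10 - y ^ 9 - 1) ^ 2 * z ^ 12)))"

end

theory Submission
  imports Defs "HOL-Analysis.Complex_Transcendental"
begin

text \<open>
  Write \<open>x, y, z, w\<close> for \<open>\<mu>(n - 1), \<dots>, \<mu>(n + 2)\<close>. Their squares are in arithmetic progression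
  with difference \<open>a = 2\<pi>\<^sup>2/3\<close>, so the differences of \<open>\<mu>\<close> are explicit:
  the third one is at most \<open>(3/8) a\<^sup>3 / x\<^sup>5 = (\<pi>\<^sup>6/9) / x\<^sup>5 < 106.9 / x\<^sup>5\<close>.
  The quotient \<open>g(n + 1) / f(n)\<close> is the exponential of this third difference, times the exponential
  of the third difference of \<open>ln ((x - 1) / x\<^sup>3)\<close>, which is nonpositive because the third derivative
  with respect to \<open>x\<^sup>2\<close> is, times a correction of relative size \<open>O(1 / x\<^sup>1\<^sup>0)\<close> from the terms \<open>\<plusminus>1\<close>.
  For \<open>n \<ge> 6\<close> one has \<open>f(n) \<le> 1\<close>, and the second order term of the exponential fits into the gap
  between 106.9 and 110. For \<open>n \<le> 5\<close> the bound on the third difference of \<open>\<mu>\<close> improves considerably,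
  because \<open>y / x\<close>, \<open>z / x\<close>, \<open>w / x\<close> stay away from 1, and a weaker bound on \<open>f(n)\<close> suffices.
\<close>

section \<open>Third differences controlled by third derivatives\<close>

text \<open>Each integration costs one difference: \<open>k3 <= 0\<close> makes \<open>k2\<close>
  nonincreasing, hence the first difference of \<open>k1\<close> is nonincreasing, hence so is the
  second difference \<open>?psi\<close> of \<open>k\<close>. The third difference is
  \<open>?psi (s + a) - ?psi s\<close>.\<close>

lemma third_difference_nonpos:
  fixes k k1 k2 k3 :: "real \<Rightarrow> real"
  assumes "a > 0"
    and d1: "\<And>u. u \<ge> s \<Longrightarrow> (k has_real_derivative k1 u) (at u)"
    and d2: "\<And>u. u \<ge> s \<Longrightarrow> (k1 has_real_derivative k2 u) (at u)"
    and d3: "\<And>u. u \<ge> s \<Longrightarrow> (k2 has_real_derivative k3 u) (at u)"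
    and nonpos: "\<And>u. u \<ge> s \<Longrightarrow> k3 u \<le> 0"
  shows "k (s + 3 * a) - 3 * k (s + 2 * a) + 3 * k (s + a) - k s \<le> 0"
proof -
  have shift_k: "((\<lambda>u. k (u + c)) has_real_derivative k1 (u + c)) (at u)" if "u + c \<ge> s" for u c
    using d1[OF that] by (simp add: DERIV_shift)
  have shift_k1: "((\<lambda>u. k1 (u + c)) has_real_derivative k2 (u + c)) (at u)" if "u + c \<ge> s" for u c
    using d2[OF that] by (simp add: DERIV_shift)
  have k2: "k2 (v + a) \<le> k2 v" if "v \<ge> s" for v
  proof (rule DERIV_nonpos_imp_nonincreasing[of v "v + a" k2])
    fix u assume "v \<le> u"
    then have "u \<ge> s" using that by simp
    then show "\<exists>y. (k2 has_real_derivative y) (at u) \<and> y \<le> 0"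
      using d3 nonpos by blast
  qed (use \<open>a > 0\<close> in simp)
  have k1: "k1 (v + a + a) - k1 (v + a) \<le> k1 (v + a) - k1 v" if "v \<ge> s" for v
  proof (rule DERIV_nonpos_imp_nonincreasing[of v "v + a" "\<lambda>u. k1 (u + a) - k1 u"])
    fix u assume "v \<le> u"
    then have "((\<lambda>u. k1 (u + a) - k1 u) has_real_derivative k2 (u + a) - k2 u) (at u)"
      using that \<open>a > 0\<close> by (intro DERIV_diff d2 shift_k1) simp_all
    then show "\<exists>y. ((\<lambda>u. k1 (u + a) - k1 u) has_real_derivative y) (at u) \<and> y \<le> 0"
      using k2[of u] \<open>v \<le> u\<close> that by (intro exI conjI) auto
  qed (use \<open>a > 0\<close> in simp)
  let ?psi = "\<lambda>u. k (u + 2 * a) - 2 * k (u + a) + k u"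
  have "?psi (s + a) \<le> ?psi s"
  proof (rule DERIV_nonpos_imp_nonincreasing[of s "s + a" ?psi])
    fix u assume "s \<le> u"
    then have "(?psi has_real_derivative k1 (u + 2 * a) - 2 * k1 (u + a) + k1 u) (at u)"
      using \<open>a > 0\<close> shift_k[of u "2 * a"] shift_k[of u a] d1[of u]
      by (auto intro!: derivative_eq_intros)
    moreover have "k1 (u + 2 * a) - 2 * k1 (u + a) + k1 u \<le> 0"
    proof -
      have "u + a + a = u + 2 * a" by simp
      show ?thesis using k1[OF \<open>s \<le> u\<close>] unfolding \<open>u + a + a = u + 2 * a\<close> by linarith
    qed
    ultimately show "\<exists>y. (?psi has_real_derivative y) (at u) \<and> y \<le> 0"
      by blast
  qed (use \<open>a > 0\<close> in simp)
  then show ?thesis by (simp add: algebra_simps)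
qed

text \<open>Here \<open>k (t^2)\<close> is \<open>ln ((t - 1) / t^3)\<close> for
  \<open>t > 1\<close>. The variable \<open>u = t^2\<close> is chosen because the squares of the
  arguments, not the arguments themselves, are equally spaced.\<close>

lemma third_difference_ln_rational_nonpos:
  fixes s a :: real
  defines "k \<equiv> \<lambda>u. ln (sqrt u - 1) - 3 / 2 * ln u"
  assumes "a > 0" and "s \<ge> (5 / 2)\<^sup>2"
  shows "k (s + 3 * a) - 3 * k (s + 2 * a) + 3 * k (s + a) - k s \<le> 0"
proof -
  \<comment> \<open>The derivatives of \<open>k\<close> with respect to \<open>u\<close>, as rational functions of \<open>r = sqrt u\<close>.\<close>
  define K1 where "K1 = (\<lambda>r::real. (3 - 2 * r) / (2 * r ^ 2 * (r - 1)))"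
  define K2 where "K2 = (\<lambda>r::real. (4 * r\<^sup>2 - 11 * r + 6) / (4 * r ^ 4 * (r - 1) ^ 2))"
  define K3 where "K3 = (\<lambda>r::real. - (16 * r ^ 3 - 63 * r ^ 2 + 69 * r - 24) / (8 * r ^ 6 * (r - 1) ^ 3))"
  \<comment> \<open>With \<open>u = r^2\<close> one has du/dr = 2r, so the derivative in
    \<open>r\<close> is \<open>2 * r\<close> times the derivative in \<open>u\<close>.\<close>
  have K1': "(K1 has_real_derivative 2 * r * K2 r) (at r)" if "r > 1" for r
  proof -
    have "(K1 has_real_derivative
        (- 2 * (2 * r ^ 2 * (r - 1)) - (3 - 2 * r) * (4 * r * (r - 1) + 2 * r\<^sup>2)) / (2 * r ^ 2 * (r - 1))\<^sup>2) (at r)"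
      unfolding K1_def using that
      by (auto intro!: derivative_eq_intros simp: power2_eq_square algebra_simps)
    moreover have "(- 2 * (2 * r ^ 2 * (r - 1)) - (3 - 2 * r) * (4 * r * (r - 1) + 2 * r\<^sup>2))
        = 2 * r * (4 * r\<^sup>2 - 11 * r + 6)"
      by (simp add: algebra_simps eval_nat_numeral)
    moreover have "2 * r * (4 * r\<^sup>2 - 11 * r + 6) / (2 * r ^ 2 * (r - 1))\<^sup>2 = 2 * r * K2 r"
      by (simp add: K2_def power_mult_distrib flip: power_mult)
    ultimately show ?thesis by metis
  qed
  have K2': "(K2 has_real_derivative 2 * r * K3 r) (at r)" if "r > 1" for r
  proof -
    have "((\<lambda>r::real. 4 * r\<^sup>2 - 11 * r + 6) has_real_derivative 8 * r - 11) (at r)"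
      by (auto intro!: derivative_eq_intros)
    moreover have "((\<lambda>r::real. 4 * r ^ 4 * (r - 1) ^ 2) has_real_derivative
        16 * r ^ 3 * (r - 1) ^ 2 + 8 * r ^ 4 * (r - 1)) (at r)"
      by (auto intro!: derivative_eq_intros)
    moreover have "4 * r ^ 4 * (r - 1) ^ 2 \<noteq> 0"
      using that by simp
    ultimately have "(K2 has_real_derivative
        ((8 * r - 11) * (4 * r ^ 4 * (r - 1) ^ 2) -
         (4 * r\<^sup>2 - 11 * r + 6) * (16 * r ^ 3 * (r - 1) ^ 2 + 8 * r ^ 4 * (r - 1))) / (4 * r ^ 4 * (r - 1) ^ 2)\<^sup>2) (at r)"
      unfolding K2_def power2_eq_square[of "4 * r ^ 4 * (r - 1)\<^sup>2"] by (rule DERIV_divide)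
    moreover have "((8 * r - 11) * (4 * r ^ 4 * (r - 1) ^ 2) -
         (4 * r\<^sup>2 - 11 * r + 6) * (16 * r ^ 3 * (r - 1) ^ 2 + 8 * r ^ 4 * (r - 1)))
        = (4 * r ^ 3 * (r - 1)) * - (16 * r ^ 3 - 63 * r ^ 2 + 69 * r - 24)"
      by (simp add: algebra_simps eval_nat_numeral)
    moreover have "(4 * r ^ 3 * (r - 1)) * - (16 * r ^ 3 - 63 * r ^ 2 + 69 * r - 24) / (4 * r ^ 4 * (r - 1) ^ 2)\<^sup>2
        = 2 * r * K3 r"
    proof -
      have "(4 * r ^ 4 * (r - 1) ^ 2)\<^sup>2 = (4 * r ^ 3 * (r - 1)) * (4 * r ^ 5 * (r - 1) ^ 3)"
        by (simp add: power_mult_distrib eval_nat_numeral)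
      moreover have "8 * r ^ 6 * (r - 1) ^ 3 = 2 * r * (4 * r ^ 5 * (r - 1) ^ 3)"
        by (simp add: eval_nat_numeral)
      \<comment> \<open>Cancellation in abstract form, to be instantiated with
        \<open>c = 4 * r^3 * (r - 1)\<close> and \<open>b = 2 * r\<close>, so that no polynomial
        gets expanded.\<close>
      moreover have "c * m / (c * e) = b * (m / (b * e))" if "c \<noteq> 0" "b \<noteq> 0" for b c e m :: real
        using that by simp
      moreover have "4 * r ^ 3 * (r - 1) \<noteq> 0" "2 * r \<noteq> 0"
        using that by auto
      ultimately show ?thesis
        unfolding K3_def by metis
    qed
    ultimately show ?thesis by metis
  qed
  have via_sqrt: "((\<lambda>u. F (sqrt u)) has_real_derivative D) (at u)"
    if "(F has_real_derivative 2 * sqrt u * D) (at (sqrt u))" "u > 0" for F D and u :: real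
    using DERIV_chain2[OF that(1) DERIV_real_sqrt[OF that(2)]] that(2) by (simp add: field_simps)
  show ?thesis
  proof (rule third_difference_nonpos[OF \<open>a > 0\<close>, where ?k1.0 = "\<lambda>u. K1 (sqrt u)"
        and ?k2.0 = "\<lambda>u. K2 (sqrt u)" and ?k3.0 = "\<lambda>u. K3 (sqrt u)"])
    fix u assume "s \<le> u"
    define r where "r = sqrt u"
    have r: "r \<ge> 5 / 2"
      unfolding r_def using \<open>s \<le> u\<close> assms(3) by (intro real_le_rsqrt) simp
    have "u > 1"
      using \<open>s \<le> u\<close> assms(3) by (simp add: power2_eq_square)
    then have "u > 0" by simp
    then have u: "u = r\<^sup>2"
      unfolding r_def by simp
    have "(k has_real_derivative inverse r / 2 / (r - 1) - 3 / (2 * u)) (at u)"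
      unfolding k_def using \<open>u > 1\<close>
      by (auto intro!: derivative_eq_intros simp: r_def)
    moreover have "inverse r / 2 / (r - 1) - 3 / (2 * u) = K1 r"
      using r unfolding K1_def u by (simp add: field_simps power2_eq_square)
    ultimately show "(k has_real_derivative K1 (sqrt u)) (at u)"
      by (simp add: r_def)
    show "((\<lambda>u. K1 (sqrt u)) has_real_derivative K2 (sqrt u)) (at u)"
      using \<open>u > 1\<close> by (intro via_sqrt K1') simp_all
    show "((\<lambda>u. K2 (sqrt u)) has_real_derivative K3 (sqrt u)) (at u)"
      using \<open>u > 1\<close> by (intro via_sqrt K2') simp_all
    \<comment> \<open>Expanding the cubic around 5/2 gives only positive coefficients, so its sign
      for \<open>r >= 5/2\<close> can be read off.\<close>
    define d where "d = r - 5 / 2"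
    have "d \<ge> 0" "r = d + 5 / 2" using r by (auto simp: d_def)
    then have "16 * r ^ 3 - 63 * r ^ 2 + 69 * r - 24 = 16 * d ^ 3 + 57 * d ^ 2 + 54 * d + 19 / 4"
      by (simp add: power3_eq_cube power2_eq_square algebra_simps)
    also have "\<dots> \<ge> 0" using \<open>d \<ge> 0\<close> by simp
    finally have "K3 r \<le> 0"
      unfolding K3_def using r by (intro divide_nonpos_nonneg) auto
    then show "K3 (sqrt u) \<le> 0" by (simp add: r_def)
  qed
qed

section \<open>Differences of square roots of an arithmetic progression\<close>

text \<open>Rationalise twice: first both consecutive differences, then the \<open>z - x\<close>
  that appears when the two resulting fractions are subtracted.\<close>

lemma second_difference_sqrt:
  fixes x y z a :: real
  assumes "x > 0" "y > 0" "z > 0" and "y\<^sup>2 = x\<^sup>2 + a" "z\<^sup>2 = x\<^sup>2 + 2 * a"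
  shows "x - 2 * y + z = - 2 * a\<^sup>2 / ((x + y) * (y + z) * (x + z))"
proof -
  have a: "y - x = a / (x + y)" "z - y = a / (y + z)" "z - x = 2 * a / (x + z)"
    using assms by (simp_all add: field_simps power2_eq_square)
  have "x - 2 * y + z = a / (y + z) - a / (x + y)"
    using a by simp
  also have "\<dots> = - a * (z - x) / ((x + y) * (y + z))"
    using assms by (simp add: field_simps)
  finally show ?thesis
    unfolding a(3) by (simp add: power2_eq_square mult_ac)
qed

lemma third_difference_sqrt:
  fixes x y z w a :: real
  assumes pos: "x > 0" "y > 0" "z > 0" "w > 0"
    and sq: "y\<^sup>2 = x\<^sup>2 + a" "z\<^sup>2 = x\<^sup>2 + 2 * a" "w\<^sup>2 = x\<^sup>2 + 3 * a"
  shows "w - 3 * z + 3 * y - x =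
    6 * a ^ 3 * (1 / (x + w) + 1 / (y + z)) / ((x + y) * (x + z) * (y + w) * (z + w))"
proof -
  have wx: "w - x = 3 * a / (x + w)"
    using assms by (simp add: field_simps power2_eq_square)
  have "w - 3 * z + 3 * y - x = (y - 2 * z + w) - (x - 2 * y + z)"
    by simp
  also have "\<dots> = - 2 * a\<^sup>2 / ((y + z) * (z + w) * (y + w)) + 2 * a\<^sup>2 / ((x + y) * (y + z) * (x + z))"
    using second_difference_sqrt[of x y z a] second_difference_sqrt[of y z w a] assms by simp
  \<comment> \<open>Uses \<open>(z + w) * (y + w) - (x + y) * (x + z) = (w - x) * (x + y + z +
    w)\<close>. Grouping the last factor as \<open>(x + w) + (y + z)\<close> lets it split into two
    reciprocals below.\<close>
  also have "\<dots> = 2 * a\<^sup>2 * ((w - x) * ((x + w) + (y + z)) / (y + z)) / ((x + y) * (x + z) * (y + w) * (z + w))"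
    using pos by (simp add: divide_simps) (simp add: algebra_simps)
  also have "(w - x) * ((x + w) + (y + z)) / (y + z) = 3 * a * (1 / (x + w) + 1 / (y + z))"
    unfolding wx using pos by (simp add: divide_simps) 
  finally show ?thesis
    by (simp add: power2_eq_square power3_eq_cube mult.assoc)
qed

text \<open>The exact formula is decreasing in \<open>y\<close>, \<open>z\<close>, \<open>w\<close>
  and homogeneous of degree -5 in the four roots. With all three ratios equal to 1 the coefficient
  is \<open>3/8 * a^3\<close>.\<close>

lemma third_difference_sqrt_le:
  fixes x y z w a \<alpha> \<beta> \<gamma> :: real
  assumes "x > 0" "a \<ge> 0" "\<alpha> > 0" "\<beta> > 0" "\<gamma> > 0"
    and le: "y \<ge> \<alpha> * x" "z \<ge> \<beta> * x" "w \<ge> \<gamma> * x"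
    and sq: "y\<^sup>2 = x\<^sup>2 + a" "z\<^sup>2 = x\<^sup>2 + 2 * a" "w\<^sup>2 = x\<^sup>2 + 3 * a"
  shows "w - 3 * z + 3 * y - x \<le> 6 * a ^ 3 * (1 / (1 + \<gamma>) + 1 / (\<alpha> + \<beta>)) /
    ((1 + \<alpha>) * (1 + \<beta>) * (\<alpha> + \<gamma>) * (\<beta> + \<gamma>)) / x ^ 5"
proof -
  have pos: "y > 0" "z > 0" "w > 0"
    using assms by (meson less_le_trans mult_pos_pos)+
  have "w - 3 * z + 3 * y - x =
      6 * a ^ 3 * (1 / (x + w) + 1 / (y + z)) / ((x + y) * (x + z) * (y + w) * (z + w))"
    using third_difference_sqrt assms pos by blast
  also have "\<dots> \<le> 6 * a ^ 3 * (1 / ((1 + \<gamma>) * x) + 1 / ((\<alpha> + \<beta>) * x)) /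
      (((1 + \<alpha>) * x) * ((1 + \<beta>) * x) * ((\<alpha> + \<gamma>) * x) * ((\<beta> + \<gamma>) * x))"
    using assms pos
    by (intro frac_le mult_mono add_mono mult_nonneg_nonneg mult_pos_pos)
      (auto simp: algebra_simps intro!: add_nonneg_nonneg add_pos_pos)
  also have "\<dots> = 6 * a ^ 3 * (1 / (1 + \<gamma>) + 1 / (\<alpha> + \<beta>)) /
      ((1 + \<alpha>) * (1 + \<beta>) * (\<alpha> + \<gamma>) * (\<beta> + \<gamma>)) / x ^ 5"
  proof -
    have "1 / ((1 + \<gamma>) * x) + 1 / ((\<alpha> + \<beta>) * x) = (1 / (1 + \<gamma>) + 1 / (\<alpha> + \<beta>)) / x"
      by (simp add: add_divide_distrib)
    then show ?thesis by (simp add: eval_nat_numeral mult_ac)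
  qed
  finally show ?thesis .
qed

section \<open>The rational factors and their ratios\<close>

text \<open>
  \<open>Q 1\<close> and \<open>Q (- 1)\<close> are the factors occurring in \<^const>\<open>f\<close> and \<^const>\<open>g\<close>;
  \<open>Q 0\<close> is their common main part \<open>(t - 1) / t\<^sup>3\<close>.
\<close>

definition Q :: "real \<Rightarrow> real \<Rightarrow> real" where
  "Q c t = (t ^ 10 - t ^ 9 + c) / t ^ 12"

lemma f_eq_Q:
  "f n = exp (mu (n - 1) - 2 * mu n + mu (n + 1)) *
    (Q (- 1) (mu (n - 1)) * Q (- 1) (mu (n + 1)) / (Q 1 (mu n))\<^sup>2)"
  by (simp add: f_def Q_def Let_def power_divide mult_ac flip: power_mult)

lemma g_eq_Q:
  "g n = exp (mu (n - 1) - 2 * mu n + mu (n + 1)) *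
    (Q 1 (mu (n - 1)) * Q 1 (mu (n + 1)) / (Q (- 1) (mu n))\<^sup>2)"
  by (simp add: g_def Q_def Let_def power_divide mult_ac flip: power_mult)

lemma Q_0_eq: "t \<noteq> 0 \<Longrightarrow> Q 0 t = (t - 1) / t ^ 3"
proof -
  assume "t \<noteq> 0"
  have "t ^ 10 - t ^ 9 + 0 = t ^ 9 * (t - 1)" "t ^ 12 = t ^ 9 * t ^ 3"
    by (simp_all add: algebra_simps eval_nat_numeral)
  moreover have "t ^ 9 * (t - 1) / (t ^ 9 * t ^ 3) = (t - 1) / t ^ 3"
    using \<open>t \<noteq> 0\<close> by (intro mult_divide_mult_cancel_left) simp
  ultimately show ?thesis by (metis Q_def)
qed

lemma power10_minus_power9_mono:
  fixes x t :: real
  assumes "1 \<le> x" "x \<le> t"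
  shows "x ^ 10 - x ^ 9 \<le> t ^ 10 - t ^ 9"
proof -
  have "x ^ 9 * (x - 1) \<le> t ^ 9 * (t - 1)"
    using assms by (intro mult_mono power_mono) auto
  then show ?thesis
    by (simp add: algebra_simps eval_nat_numeral)
qed

lemma Q_pos:
  assumes "t \<ge> 2" "c \<ge> - 1"
  shows "Q c t > 0"
proof -
  have "t ^ 10 - t ^ 9 > 1"
    using power10_minus_power9_mono[of 2 t] assms by simp
  then show ?thesis
    unfolding Q_def using assms by (intro divide_pos_pos) auto
qed

text \<open>Since \<open>ln (Q 0 t)\<close> is the \<open>k (t^2)\<close> of
  \<open>third_difference_ln_rational_nonpos\<close>, the logarithm of the claim is that lemma at
  \<open>s = x^2\<close>.\<close>

lemma Q_0_third_ratio_le: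
  fixes x y z w a :: real
  assumes x: "x \<ge> 5 / 2" and "a > 0" and pos: "y > 0" "z > 0" "w > 0"
    and sq: "y\<^sup>2 = x\<^sup>2 + a" "z\<^sup>2 = x\<^sup>2 + 2 * a" "w\<^sup>2 = x\<^sup>2 + 3 * a"
  shows "Q 0 y ^ 3 * Q 0 w \<le> Q 0 z ^ 3 * Q 0 x"
proof -
  have ge: "y > 1" "z > 1" "w > 1" "x > 1"
  proof -
    have "x\<^sup>2 \<ge> (5 / 2)\<^sup>2"
      using x by (intro power_mono) auto
    then have "1\<^sup>2 < y\<^sup>2" "1\<^sup>2 < z\<^sup>2" "1\<^sup>2 < w\<^sup>2"
      using sq \<open>a > 0\<close> by (simp_all add: power2_eq_square)
    then show "y > 1" "z > 1" "w > 1" "x > 1"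
      using pos x by (auto intro: power2_less_imp_less)
  qed
  have Qpos: "Q 0 t > 0" if "t > 1" for t
    using that by (simp add: Q_0_eq)
  define k :: "real \<Rightarrow> real" where "k = (\<lambda>u. ln (sqrt u - 1) - 3 / 2 * ln u)"
  have k: "ln (Q 0 t) = k (t\<^sup>2)" if "t > 1" for t
    using that by (simp add: Q_0_eq k_def ln_div ln_realpow)
  have "k (x\<^sup>2 + 3 * a) - 3 * k (x\<^sup>2 + 2 * a) + 3 * k (x\<^sup>2 + a) - k (x\<^sup>2) \<le> 0"
    unfolding k_def using x \<open>a > 0\<close>
    by (intro third_difference_ln_rational_nonpos power_mono) auto
  then have "3 * ln (Q 0 y) + ln (Q 0 w) \<le> 3 * ln (Q 0 z) + ln (Q 0 x)"
    using sq ge by (simp add: k)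
  then have "ln (Q 0 y ^ 3 * Q 0 w) \<le> ln (Q 0 z ^ 3 * Q 0 x)"
    using ge[THEN Qpos] by (simp add: ln_mult_pos ln_realpow)
  then show ?thesis
    using ge Qpos by (subst (asm) ln_le_cancel_iff) auto
qed

lemma Q_1_le_exp:
  assumes "1 < x" "x \<le> t"
  shows "Q 1 t \<le> Q 0 t * exp (1 / (x ^ 10 - x ^ 9))"
proof -
  have le: "x ^ 10 - x ^ 9 \<le> t ^ 10 - t ^ 9"
    using assms by (intro power10_minus_power9_mono) auto
  have pos: "x ^ 10 - x ^ 9 > 0"
    using assms by (simp add: power_strict_increasing)
  have "t ^ 10 - t ^ 9 + 1 \<le> (t ^ 10 - t ^ 9) * (1 + 1 / (x ^ 10 - x ^ 9))"
    using le pos by (simp add: field_simps)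
  also have "\<dots> \<le> (t ^ 10 - t ^ 9) * exp (1 / (x ^ 10 - x ^ 9))"
    using le pos by (intro mult_left_mono exp_ge_add_one_self) auto
  finally show ?thesis
    unfolding Q_def using assms by (simp add: divide_right_mono)
qed

lemma Q_0_le_exp:
  assumes "1 < x" "x \<le> t" "x ^ 10 - x ^ 9 \<ge> 2"
  shows "Q 0 t \<le> Q (- 1) t * exp (2 / (x ^ 10 - x ^ 9))"
proof -
  have le: "x ^ 10 - x ^ 9 \<le> t ^ 10 - t ^ 9"
    using assms by (intro power10_minus_power9_mono) auto
  \<comment> \<open>With P and p the values of \<open>t^10 - t^9\<close> at \<open>t\<close> and at
    \<open>x\<close>, this amounts to p <= 2(P - 1), which follows from P >= p >= 2. This is where
    the 2 in the exponent comes from.\<close>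
  have "t ^ 10 - t ^ 9 \<le> (t ^ 10 - t ^ 9 - 1) * (1 + 2 / (x ^ 10 - x ^ 9))"
    using le assms(3) by (simp add: field_simps)
  also have "\<dots> \<le> (t ^ 10 - t ^ 9 - 1) * exp (2 / (x ^ 10 - x ^ 9))"
    using le assms(3) by (intro mult_left_mono exp_ge_add_one_self) auto
  finally show ?thesis
    unfolding Q_def using assms by (simp add: divide_right_mono)
qed

text \<open>Cross-multiplied, there are four factors \<open>Q 1\<close>, each costing
  \<open>exp p\<close>, and four factors \<open>Q (- 1)\<close>, each costing
  \<open>exp (2 * p)\<close>. Hence 12 = 4 + 8.\<close>

lemma Q_third_ratio_le:
  fixes x y z w a :: real
  assumes x: "x \<ge> 5 / 2" and "a > 0" and pos: "y > 0" "z > 0" "w > 0"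
    and sq: "y\<^sup>2 = x\<^sup>2 + a" "z\<^sup>2 = x\<^sup>2 + 2 * a" "w\<^sup>2 = x\<^sup>2 + 3 * a"
  shows "Q 1 y * Q 1 w / (Q (- 1) z)\<^sup>2 \<le>
    exp (12 / (x ^ 10 - x ^ 9)) * (Q (- 1) x * Q (- 1) z / (Q 1 y)\<^sup>2)"
proof -
  define p where "p = 1 / (x ^ 10 - x ^ 9)"
  have ge: "x \<le> y" "x \<le> z" "x \<le> w" "1 < x"
    using sq pos x \<open>a > 0\<close> by (auto intro: power2_le_imp_le)
  have P2: "x ^ 10 - x ^ 9 \<ge> 2"
    using power10_minus_power9_mono[of 2 x] x by simp
  have Qpos: "Q c t > 0" if "x \<le> t" "c \<ge> - 1" for c t
    using that x by (intro Q_pos) auto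
  have up: "Q 1 t \<le> Q 0 t * exp p" if "x \<le> t" for t
    unfolding p_def using Q_1_le_exp that ge by blast
  have down: "Q 0 t \<le> Q (- 1) t * exp (2 * p)" if "x \<le> t" for t
    unfolding p_def using Q_0_le_exp[of x t] that ge P2 by simp
  have "Q 1 y ^ 3 * Q 1 w \<le> (Q 0 y * exp p) ^ 3 * (Q 0 w * exp p)"
    using ge Qpos by (intro mult_mono power_mono up) (auto intro: less_imp_le)
  also have "\<dots> = exp (4 * p) * (Q 0 y ^ 3 * Q 0 w)"
    by (simp add: power_mult_distrib mult_ac flip: exp_add exp_of_nat_mult)
  also have "\<dots> \<le> exp (4 * p) * (Q 0 z ^ 3 * Q 0 x)"
    using Q_0_third_ratio_le[OF assms] by simp
  also have "\<dots> \<le> exp (4 * p) * ((Q (- 1) z * exp (2 * p)) ^ 3 * (Q (- 1) x * exp (2 * p)))"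
    using ge Qpos by (intro mult_left_mono mult_mono power_mono down) (auto intro: less_imp_le)
  also have "\<dots> = exp (12 * p) * (Q (- 1) z ^ 3 * Q (- 1) x)"
    by (simp add: power_mult_distrib mult_ac flip: exp_add exp_of_nat_mult)
  finally have "Q 1 y ^ 3 * Q 1 w \<le> exp (12 * p) * (Q (- 1) z ^ 3 * Q (- 1) x)" .
  then have "Q 1 y * Q 1 w / (Q (- 1) z)\<^sup>2 \<le> exp (12 * p) * (Q (- 1) x * Q (- 1) z / (Q 1 y)\<^sup>2)"
    using Qpos[OF ge(1), of 1] Qpos[OF ge(2), of "- 1"]
    by (simp add: field_simps power2_eq_square power3_eq_cube)
  then show ?thesis by (simp add: p_def)
qed

text \<open>Replacing every \<open>Q\<close> by \<open>Q 0\<close> only increases the left side.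
  What remains besides the cube is \<open>(x - 1) * (z - 1) / (y - 1)^2\<close>, at most 1 by the
  AM-GM inequality and concavity of the square root.\<close>

lemma Q_second_ratio_le:
  fixes x y z a :: real
  assumes x: "x \<ge> 5 / 2" and "a > 0" and pos: "y > 0" "z > 0"
    and sq: "y\<^sup>2 = x\<^sup>2 + a" "z\<^sup>2 = x\<^sup>2 + 2 * a"
  shows "Q (- 1) x * Q (- 1) z / (Q 1 y)\<^sup>2 \<le> (y\<^sup>2 / (x * z)) ^ 3"
proof -
  have ge: "x \<le> y" "x \<le> z" "1 < x"
    using sq pos x \<open>a > 0\<close> by (auto intro: power2_le_imp_le)
  have Q: "Q c t > 0" if "t \<ge> x" "c \<ge> - 1" for c t
    using that x by (intro Q_pos) auto
  have mono: "Q c t \<le> Q d t" if "c \<le> d" for c d t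
    using that by (simp add: Q_def divide_right_mono)
  have "Q (- 1) x * Q (- 1) z / (Q 1 y)\<^sup>2 \<le> Q 0 x * Q 0 z / (Q 0 y)\<^sup>2"
    using ge by (intro frac_le mult_mono power_mono mono mult_nonneg_nonneg zero_less_power Q
        less_imp_le[OF Q]) auto
  also have "\<dots> = (x - 1) * (z - 1) / (y - 1)\<^sup>2 * (y\<^sup>2 / (x * z)) ^ 3"
    using ge by (simp add: Q_0_eq power_divide power_mult_distrib flip: power_mult)
  also have "\<dots> \<le> 1 * (y\<^sup>2 / (x * z)) ^ 3"
  proof (intro mult_right_mono)
    have "x - 2 * y + z = - 2 * a\<^sup>2 / ((x + y) * (y + z) * (x + z))"
      using assms by (intro second_difference_sqrt) auto
    also have "\<dots> \<le> 0"
      using ge by (intro divide_nonpos_nonneg) auto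
    finally have "((x - 1) + (z - 1)) / 2 \<le> y - 1" by simp
    then have "(((x - 1) + (z - 1)) / 2)\<^sup>2 \<le> (y - 1)\<^sup>2"
      using ge by (intro power_mono) auto
    moreover have "(x - 1) * (z - 1) \<le> (((x - 1) + (z - 1)) / 2)\<^sup>2"
      using zero_le_power2[of "x - z"] by (simp add: power2_eq_square field_simps)
    ultimately have "(x - 1) * (z - 1) \<le> (y - 1)\<^sup>2" by (rule order_trans[rotated])
    then show "(x - 1) * (z - 1) / (y - 1)\<^sup>2 \<le> 1"
      using ge by (simp add: divide_le_eq)
  qed (use ge in auto)
  finally show ?thesis by simp
qed

section \<open>From the quotient to the additive gap\<close>

text \<open>For \<open>0 <= h <= l <= 1\<close> one has
  \<open>exp h - 1 <= h + h^2 <= h * (1 + l)\<close>. With \<open>h = c / T\<close> this turns a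
  multiplicative error on \<open>F <= C\<close> into an additive one; \<open>T\<close> will be
  \<open>x^5\<close>.\<close>

lemma add_exp_correction_less:
  fixes F G c C K l T :: real
  assumes G: "G \<le> exp (c / T) * F" and F: "0 \<le> F" "F \<le> C" and "T > 0" "c \<ge> 0"
    and l: "c \<le> l * T" "l \<le> 1" and K: "C * c * (1 + l) < K"
  shows "G < F + K / T"
proof -
  have L: "0 \<le> c / T" "c / T \<le> l"
    using assms by (auto simp: field_simps)
  then have "exp (c / T) - 1 \<le> c / T + (c / T)\<^sup>2"
    using exp_bound[of "c / T"] l by simp
  also have "\<dots> = c / T * (1 + c / T)"
    by (simp add: algebra_simps power2_eq_square)
  also have "\<dots> \<le> c / T * (1 + l)"
    using L by (intro mult_left_mono) auto
  finally have "F * (exp (c / T) - 1) \<le> C * (c / T * (1 + l))"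
    using F L by (intro mult_mono) auto
  also have "\<dots> = C * c * (1 + l) / T"
    by simp
  also have "\<dots> < K / T"
    using K \<open>T > 0\<close> by (intro divide_strict_right_mono)
  finally show ?thesis
    using G by (simp add: algebra_simps)
qed

lemma four_square_roots_gap_less:
  fixes x y z w a :: real
  defines "F \<equiv> exp (x - 2 * y + z) * (Q (- 1) x * Q (- 1) z / (Q 1 y)\<^sup>2)"
  assumes x: "x \<ge> 5 / 2" and "a > 0" and pos: "y > 0" "z > 0" "w > 0"
    and sq: "y\<^sup>2 = x\<^sup>2 + a" "z\<^sup>2 = x\<^sup>2 + 2 * a" "w\<^sup>2 = x\<^sup>2 + 3 * a"
    and D: "w - 3 * z + 3 * y - x \<le> c / x ^ 5" and "c \<ge> 0"
    and C: "F \<le> C" and l: "c + 1 / 4 \<le> l * x ^ 5" "l \<le> 1"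
    and K: "C * (c + 1 / 4) * (1 + l) < K"
  shows "exp (y - 2 * z + w) * (Q 1 y * Q 1 w / (Q (- 1) z)\<^sup>2) < F + K / x ^ 5"
proof (rule add_exp_correction_less[where c = "c + 1 / 4" and C = C and l = l])
  have ge: "x \<le> z"
    using sq pos x \<open>a > 0\<close> by (auto intro: power2_le_imp_le)
  \<comment> \<open>The left side exceeds 48, so the correction \<open>12 / (x^10 - x^9)\<close> is
    at most 12/48 = 1/4 over \<open>x^5\<close>; this is the 1/4 added to \<open>c\<close>.\<close>
  have "(5 / 2) ^ 4 * (5 / 2 - 1) \<le> x ^ 4 * (x - 1)"
    using x by (intro mult_mono power_mono) auto
  then have "48 \<le> x ^ 4 * (x - 1)"
    by (simp add: power_divide)
  then have "48 * x ^ 5 \<le> x ^ 4 * (x - 1) * x ^ 5"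
    using x by (intro mult_right_mono) auto
  also have "\<dots> = x ^ 10 - x ^ 9"
    by (simp add: algebra_simps eval_nat_numeral)
  finally have P: "48 * x ^ 5 \<le> x ^ 10 - x ^ 9" .
  have "12 / (x ^ 10 - x ^ 9) \<le> 12 / (48 * x ^ 5)"
    using x P by (intro divide_left_mono mult_pos_pos) (auto intro: less_le_trans[of _ "48 * x ^ 5"])
  also have "\<dots> = (1 / 4) / x ^ 5" by simp
  finally have p: "12 / (x ^ 10 - x ^ 9) \<le> (1 / 4) / x ^ 5" .
  have "Q (- 1) x > 0" "Q (- 1) z > 0"
    using x ge by (auto intro: Q_pos)
  then show F0: "0 \<le> F"
    unfolding F_def by simp
  have "exp (y - 2 * z + w) * (Q 1 y * Q 1 w / (Q (- 1) z)\<^sup>2)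
      \<le> exp (y - 2 * z + w) *
        (exp (12 / (x ^ 10 - x ^ 9)) * (Q (- 1) x * Q (- 1) z / (Q 1 y)\<^sup>2))"
    using x \<open>a > 0\<close> pos sq by (intro mult_left_mono Q_third_ratio_le) auto
  \<comment> \<open>The second difference at \<open>y, z, w\<close> is the one at
    \<open>x, y, z\<close>, absorbed into \<open>F\<close>, plus the third difference.\<close>
  also have "\<dots> = exp ((w - 3 * z + 3 * y - x) + 12 / (x ^ 10 - x ^ 9)) * F"
    unfolding F_def mult.assoc[symmetric] exp_add[symmetric]
    by (simp add: algebra_simps)
  also have "\<dots> \<le> exp ((c + 1 / 4) / x ^ 5) * F"
    using D p F0 by (intro mult_right_mono) (auto simp: add_divide_distrib)
  finally show "exp (y - 2 * z + w) * (Q 1 y * Q 1 w / (Q (- 1) z)\<^sup>2) \<le> exp ((c + 1 / 4) / x ^ 5) * F" .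
qed (use assms in auto)

section \<open>Upper bounds for the value of \<open>f\<close>\<close>

text \<open>A crude bound for small arguments: the exponential is estimated by 1, and
  \<open>t\<close> bounds \<open>y^2 / (x * z)\<close>, with the condition squared to avoid
  roots.\<close>

lemma exp_Q_second_ratio_le_cube:
  fixes x y z a t :: real
  assumes x: "x \<ge> 5 / 2" and "a > 0" and pos: "y > 0" "z > 0"
    and sq: "y\<^sup>2 = x\<^sup>2 + a" "z\<^sup>2 = x\<^sup>2 + 2 * a"
    and t: "(x\<^sup>2 + a)\<^sup>2 \<le> t\<^sup>2 * (x\<^sup>2 * (x\<^sup>2 + 2 * a))" "t \<ge> 0"
  shows "exp (x - 2 * y + z) * (Q (- 1) x * Q (- 1) z / (Q 1 y)\<^sup>2) \<le> t ^ 3"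
proof -
  have "x - 2 * y + z = - 2 * a\<^sup>2 / ((x + y) * (y + z) * (x + z))"
    using assms by (intro second_difference_sqrt) auto
  also have "\<dots> \<le> 0"
    using x pos by (intro divide_nonpos_nonneg) auto
  finally have e: "exp (x - 2 * y + z) \<le> 1" by simp
  have "(y\<^sup>2)\<^sup>2 \<le> (t * (x * z))\<^sup>2"
    using t sq by (simp add: power_mult_distrib)
  then have "y\<^sup>2 \<le> t * (x * z)"
    using t x pos by (intro power2_le_imp_le[of "y\<^sup>2"]) auto
  then have "y\<^sup>2 / (x * z) \<le> t"
    using x pos by (simp add: divide_le_eq)
  then have le: "(y\<^sup>2 / (x * z)) ^ 3 \<le> t ^ 3"
    using x pos by (intro power_mono) auto
  have "exp (x - 2 * y + z) * (Q (- 1) x * Q (- 1) z / (Q 1 y)\<^sup>2)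
      \<le> exp (x - 2 * y + z) * (y\<^sup>2 / (x * z)) ^ 3"
    using Q_second_ratio_le[of x a y z] assms by (intro mult_left_mono) auto
  also have "\<dots> \<le> 1 * (y\<^sup>2 / (x * z)) ^ 3"
    using e x pos by (intro mult_right_mono) auto
  finally show ?thesis using le by simp
qed

text \<open>The exponential compensates the cube. With \<open>q = a^2 / (x^2 * z^2)\<close>, the
  square of \<open>y^2 / (x * z)\<close> is \<open>1 + q <= exp q\<close>, so its cube is at most
  \<open>exp (3/2 * q)\<close>, while the second difference is at most \<open>- 3/2 * q\<close>. The
  latter reduces to \<open>(x + y) * (y + z) * (x + z) <= 4/3 * x^2 * z^2\<close>, a cubic against a
  quartic.\<close>

lemma exp_Q_second_ratio_le_1:
  fixes x y z a :: real
  assumes "a \<ge> 657 / 100" and xa: "x\<^sup>2 \<ge> 495 / 100 * a" and pos: "x \<ge> 5 / 2" "y > 0" "z > 0"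
    and sq: "y\<^sup>2 = x\<^sup>2 + a" "z\<^sup>2 = x\<^sup>2 + 2 * a"
  shows "exp (x - 2 * y + z) * (Q (- 1) x * Q (- 1) z / (Q 1 y)\<^sup>2) \<le> 1"
proof -
  have "a > 0" "x > 0" using assms by auto
  define q where "q = a\<^sup>2 / (x\<^sup>2 * z\<^sup>2)"
  have sum_sq: "(u + v)\<^sup>2 \<le> 2 * (u\<^sup>2 + v\<^sup>2)" for u v :: real
    using zero_le_power2[of "u - v"] by (simp add: power2_eq_square algebra_simps)
  have "((x + y) * (y + z) * (x + z))\<^sup>2 \<le> (2 * (x\<^sup>2 + y\<^sup>2)) * (2 * (y\<^sup>2 + z\<^sup>2)) * (2 * (x\<^sup>2 + z\<^sup>2))"
    unfolding power_mult_distrib by (intro mult_mono sum_sq) auto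
  also have "\<dots> = 8 * (2 * x\<^sup>2 + a) * (2 * x\<^sup>2 + 3 * a) * (2 * x\<^sup>2 + 2 * a)"
    unfolding sq by (simp add: algebra_simps)
  also have "\<dots> \<le> 16 / 9 * (x\<^sup>2)\<^sup>2 * (x\<^sup>2 + 2 * a)\<^sup>2"
  proof -
    \<comment> \<open>In units of \<open>a\<close>, the claim compares \<open>a^3\<close> times a
      cubic in \<open>d\<close> with \<open>a^4\<close> times a quartic. The bound
      \<open>a >= 657/100\<close> supplies the missing factor, and then the difference has only
      nonnegative coefficients in \<open>d\<close>.\<close>
    define d where "d = x\<^sup>2 / a - 495 / 100"
    have d: "d \<ge> 0" "x\<^sup>2 = a * (d + 495 / 100)"
      using xa \<open>a > 0\<close> by (auto simp: d_def field_simps)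
    have "8 * (2 * x\<^sup>2 + a) * (2 * x\<^sup>2 + 3 * a) * (2 * x\<^sup>2 + 2 * a)
        = a ^ 3 * (8 * (2 * d + 109 / 10) * (2 * d + 129 / 10) * (2 * d + 119 / 10))"
      unfolding d(2) by (simp add: power3_eq_cube) algebra
    also have "\<dots> \<le> a ^ 3 * (657 / 100 * (16 / 9 * (d + 495 / 100)\<^sup>2 * (d + 695 / 100)\<^sup>2))"
    proof (intro mult_left_mono)
      have "657 / 100 * (16 / 9 * (d + 495 / 100)\<^sup>2 * (d + 695 / 100)\<^sup>2) -
        8 * (2 * d + 109 / 10) * (2 * d + 129 / 10) * (2 * d + 119 / 10) \<ge> 0"
      proof -
        have "0 \<le> d * d" "0 \<le> d * (d * d)" "0 \<le> d * (d * (d * d))"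
          using d(1) by simp_all
        then show ?thesis
          using d(1) unfolding power2_eq_square ring_distribs by (simp add: algebra_simps)
      qed
      then show "8 * (2 * d + 109 / 10) * (2 * d + 129 / 10) * (2 * d + 119 / 10)
        \<le> 657 / 100 * (16 / 9 * (d + 495 / 100)\<^sup>2 * (d + 695 / 100)\<^sup>2)" by simp
    qed (use \<open>a > 0\<close> in simp)
    also have "\<dots> \<le> a ^ 3 * (a * (16 / 9 * (d + 495 / 100)\<^sup>2 * (d + 695 / 100)\<^sup>2))"
      using assms(1) by (intro mult_left_mono mult_right_mono) auto
    also have "\<dots> = 16 / 9 * (x\<^sup>2)\<^sup>2 * (x\<^sup>2 + 2 * a)\<^sup>2"
      unfolding d(2) by (simp add: power3_eq_cube) algebra
    finally show ?thesis .
  qed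
  also have "\<dots> = (4 / 3 * (x\<^sup>2 * z\<^sup>2))\<^sup>2"
    unfolding sq(2)[symmetric] by (simp add: power_mult_distrib power_divide)
  finally have "(x + y) * (y + z) * (x + z) \<le> 4 / 3 * (x\<^sup>2 * z\<^sup>2)"
    by (rule power2_le_imp_le) auto
  then have "2 * a\<^sup>2 / (4 / 3 * (x\<^sup>2 * z\<^sup>2)) \<le> 2 * a\<^sup>2 / ((x + y) * (y + z) * (x + z))"
    using \<open>x > 0\<close> pos by (intro divide_left_mono) auto
  moreover have "2 * a\<^sup>2 / (4 / 3 * (x\<^sup>2 * z\<^sup>2)) = 3 / 2 * q"
    by (simp add: q_def)
  moreover have "x - 2 * y + z = - 2 * a\<^sup>2 / ((x + y) * (y + z) * (x + z))"
    using assms \<open>x > 0\<close> by (intro second_difference_sqrt) auto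
  ultimately have E: "x - 2 * y + z \<le> - (3 / 2 * q)"
    by simp
  have y4: "(y\<^sup>2)\<^sup>2 = x\<^sup>2 * z\<^sup>2 + a\<^sup>2"
    unfolding sq by (simp add: power2_eq_square algebra_simps)
  have "(y\<^sup>2 / (x * z))\<^sup>2 = 1 + q"
    unfolding q_def power_divide power_mult_distrib y4 using \<open>x > 0\<close> pos
    by (simp add: add_divide_distrib)
  then have "(y\<^sup>2 / (x * z))\<^sup>2 \<le> exp q"
    by simp
  then have "((y\<^sup>2 / (x * z))\<^sup>2) ^ 3 \<le> exp q ^ 3"
    by (intro power_mono) auto
  then have "((y\<^sup>2 / (x * z)) ^ 3)\<^sup>2 \<le> (exp (3 / 2 * q))\<^sup>2"
    by (simp add: power2_eq_square power3_eq_cube mult_ac flip: exp_add)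
  then have cube: "(y\<^sup>2 / (x * z)) ^ 3 \<le> exp (3 / 2 * q)"
    by (rule power2_le_imp_le) auto
  have "exp (x - 2 * y + z) * (Q (- 1) x * Q (- 1) z / (Q 1 y)\<^sup>2)
      \<le> exp (x - 2 * y + z) * (y\<^sup>2 / (x * z)) ^ 3"
    using Q_second_ratio_le[of x a y z] assms \<open>a > 0\<close> by (intro mult_left_mono) auto
  also have "\<dots> \<le> exp (- (3 / 2 * q)) * exp (3 / 2 * q)"
    using E cube \<open>x > 0\<close> pos by (intro mult_mono) auto
  also have "\<dots> = 1"
    by (simp flip: exp_add)
  finally show ?thesis .
qed

section \<open>Numerical case analysis\<close>

text \<open>To be used with \<open>b = (pi / 6)^2\<close> and \<open>N = 24 * n - 25\<close>; the
  three cases are \<open>n = 2\<close>, \<open>3 <= n <= 5\<close> and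
  \<open>n >= 6\<close>.\<close>

lemma four_square_roots_gap_less_110:
  fixes x y z w b N :: real
  defines "a \<equiv> 24 * b"
  assumes b: "b \<ge> 0.27387" "b \<le> 0.274157"
    and N_cases: "N = 23 \<or> 47 \<le> N \<and> N \<le> 95 \<or> 119 \<le> N"
    and pos: "x > 0" "y > 0" "z > 0" "w > 0"
    and x2: "x\<^sup>2 = b * N"
    and sq: "y\<^sup>2 = x\<^sup>2 + a" "z\<^sup>2 = x\<^sup>2 + 2 * a" "w\<^sup>2 = x\<^sup>2 + 3 * a"
  shows "exp (y - 2 * z + w) * (Q 1 y * Q 1 w / (Q (- 1) z)\<^sup>2) <
    exp (x - 2 * y + z) * (Q (- 1) x * Q (- 1) z / (Q 1 y)\<^sup>2) + 110 / x ^ 5"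
proof -
  have a: "a > 0" "a \<ge> 657 / 100" "a \<le> 6.57977"
    using b by (auto simp: a_def)
  have "a ^ 3 \<le> 6.57977 ^ 3"
    using a by (intro power_mono) auto
  then have a3: "a ^ 3 \<le> 284.866"
    by (simp add: eval_nat_numeral)
  have x_ge: "r \<le> x" if "r\<^sup>2 \<le> 0.27387 * m" "m \<le> N" "0 \<le> m" "0 \<le> r" for r m
  proof -
    have "0.27387 * m \<le> b * N"
      using that b by (intro mult_mono) auto
    then show ?thesis
      using that pos x2 by (intro power2_le_imp_le[of r x]) auto
  qed
  \<comment> \<open>Since \<open>a = 24 * b\<close>, the factor \<open>b\<close> cancels: ratios of
    the roots depend on \<open>N\<close> alone. The same holds in \<open>cube\<close>.\<close>
  have ratio: "\<alpha> * x \<le> v" if "v\<^sup>2 = x\<^sup>2 + j * a" "\<alpha>\<^sup>2 * N \<le> N + 24 * j" "v > 0" for \<alpha> v j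
  proof -
    have "b * (\<alpha>\<^sup>2 * N) \<le> b * (N + 24 * j)"
      using that b by (intro mult_left_mono) auto
    moreover have "(\<alpha> * x)\<^sup>2 = b * (\<alpha>\<^sup>2 * N)" "v\<^sup>2 = b * (N + 24 * j)"
      unfolding that(1) power_mult_distrib x2 a_def by (simp_all add: algebra_simps)
    ultimately have "(\<alpha> * x)\<^sup>2 \<le> v\<^sup>2"
      by simp
    then show ?thesis by (rule power2_le_imp_le) (use that in simp)
  qed
  have cube: "(x\<^sup>2 + a)\<^sup>2 \<le> t\<^sup>2 * (x\<^sup>2 * (x\<^sup>2 + 2 * a))" if "(N + 24)\<^sup>2 \<le> t\<^sup>2 * (N * (N + 48))" for t
  proof -
    have "b\<^sup>2 * (N + 24)\<^sup>2 \<le> b\<^sup>2 * (t\<^sup>2 * (N * (N + 48)))"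
      using that by (intro mult_left_mono) auto
    moreover have "b\<^sup>2 * (N + 24)\<^sup>2 = (x\<^sup>2 + a)\<^sup>2"
      "b\<^sup>2 * (t\<^sup>2 * (N * (N + 48))) = t\<^sup>2 * (x\<^sup>2 * (x\<^sup>2 + 2 * a))"
      unfolding x2 a_def by algebra+
    ultimately show ?thesis by simp
  qed
  have N: "N \<ge> 23"
    using N_cases by auto
  have x: "x \<ge> 5 / 2"
    by (rule x_ge[of _ 23]) (use N in \<open>auto simp: power2_eq_square\<close>)
  define F where "F = exp (x - 2 * y + z) * (Q (- 1) x * Q (- 1) z / (Q 1 y)\<^sup>2)"
  have finish: "exp (y - 2 * z + w) * (Q 1 y * Q 1 w / (Q (- 1) z)\<^sup>2) < F + 110 / x ^ 5"
    if "w - 3 * z + 3 * y - x \<le> c / x ^ 5" "c \<ge> 0" "F \<le> C" "c + 1 / 4 \<le> l * r ^ 5" "0 \<le> r" "r \<le> x"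
      "0 \<le> l" "l \<le> 1" "C * (c + 1 / 4) * (1 + l) < 110" for c C l r
  proof -
    have "l * r ^ 5 \<le> l * x ^ 5"
      using that by (intro mult_left_mono power_mono) auto
    then show "exp (y - 2 * z + w) * (Q 1 y * Q 1 w / (Q (- 1) z)\<^sup>2) < F + 110 / x ^ 5"
      using that unfolding F_def by (intro four_square_roots_gap_less[of x a y z w c C l] x a pos sq) auto
  qed
  have D: "w - 3 * z + 3 * y - x \<le> c / x ^ 5"
    if "\<alpha> > 0" "\<beta> > 0" "\<gamma> > 0" "\<alpha> * x \<le> y" "\<beta> * x \<le> z" "\<gamma> * x \<le> w"
      and c: "6 * 284.866 * (1 / (1 + \<gamma>) + 1 / (\<alpha> + \<beta>)) / ((1 + \<alpha>) * (1 + \<beta>) * (\<alpha> + \<gamma>) * (\<beta> + \<gamma>)) \<le> c"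
    for \<alpha> \<beta> \<gamma> c
  proof -
    have "w - 3 * z + 3 * y - x \<le> 6 * a ^ 3 * (1 / (1 + \<gamma>) + 1 / (\<alpha> + \<beta>)) /
        ((1 + \<alpha>) * (1 + \<beta>) * (\<alpha> + \<gamma>) * (\<beta> + \<gamma>)) / x ^ 5"
      using that a pos sq by (intro third_difference_sqrt_le) auto
    also have "\<dots> \<le> 6 * 284.866 * (1 / (1 + \<gamma>) + 1 / (\<alpha> + \<beta>)) /
        ((1 + \<alpha>) * (1 + \<beta>) * (\<alpha> + \<gamma>) * (\<beta> + \<gamma>)) / x ^ 5"
      using that a3 pos by (intro divide_right_mono mult_right_mono) auto
    also have "\<dots> \<le> c / x ^ 5"
      using c pos by (intro divide_right_mono) auto
    finally show ?thesis .
  qed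
  have "exp (y - 2 * z + w) * (Q 1 y * Q 1 w / (Q (- 1) z)\<^sup>2) < F + 110 / x ^ 5"
    using N_cases
  proof (elim disjE conjE)
    assume N: "N = 23"
    show ?thesis
    proof (rule finish[of 14 "(1.17) ^ 3" "0.2" "5 / 2"])
      show "w - 3 * z + 3 * y - x \<le> 14 / x ^ 5"
        by (rule D[of "1.4" "1.7" 2]; (rule ratio[of _ 1] ratio[of _ 2] ratio[of _ 3])?)
          (use sq pos in \<open>simp_all add: N power2_eq_square\<close>)
      show "F \<le> (1.17) ^ 3"
        unfolding F_def using x a pos sq
        by (intro exp_Q_second_ratio_le_cube[of x a] cube) (auto simp: N power2_eq_square)
    qed (use x in \<open>simp_all add: eval_nat_numeral\<close>)
  next
    assume N: "47 \<le> N" "N \<le> 95"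
    show ?thesis
    proof (rule finish[of 54 "(1.07) ^ 3" "1 / 4" 3])
      show "w - 3 * z + 3 * y - x \<le> 54 / x ^ 5"
        \<comment> \<open>The ratios to \<open>x\<close> decrease in \<open>N\<close>, so these
          lower bounds are dictated by \<open>N = 95\<close>.\<close>
        by (rule D[of "1.1" "1.2" "1.3"]; (rule ratio[of _ 1] ratio[of _ 2] ratio[of _ 3])?)
          (use sq pos N in \<open>simp_all add: power2_eq_square\<close>)
      have "(N + 24)\<^sup>2 \<le> (1.07)\<^sup>2 * (N * (N + 48))"
      proof -
        \<comment> \<open>As \<open>(N + 24)^2 = N * (N + 48) + 576\<close>, the worst case is the
          smallest product, at \<open>N = 47\<close>.\<close>
        have "47 * 95 \<le> N * (N + 48)"
          using N by (intro mult_mono) auto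
        then show ?thesis by (simp add: power2_eq_square algebra_simps)
      qed
      then show "F \<le> (1.07) ^ 3"
        unfolding F_def using x a pos sq
        by (intro exp_Q_second_ratio_le_cube[of x a] cube) auto
      show "3 \<le> x"
        by (rule x_ge[of _ 47]) (use N in auto)
    qed (simp_all add: eval_nat_numeral)
  next
    assume N: "119 \<le> N"
    show ?thesis
    \<comment> \<open>The tight case: \<open>3/8 * 284.866 < 106.9\<close>, and
      \<open>(106.9 + 1/4) * 1.02 < 110\<close>.\<close>
    proof (rule finish[of "106.9" 1 "0.02" "5.7"])
      show "w - 3 * z + 3 * y - x \<le> 106.9 / x ^ 5"
        by (rule D[of 1 1 1]; (rule ratio[of _ 1] ratio[of _ 2] ratio[of _ 3])?)
          (use sq pos in simp_all)
      have "495 / 100 * 24 \<le> N" using N by simp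
      then have "b * (495 / 100 * 24) \<le> b * N"
        using b by (intro mult_left_mono) auto
      then have "495 / 100 * a \<le> x\<^sup>2"
        by (simp add: x2 a_def algebra_simps)
      then show "F \<le> 1"
        unfolding F_def using x a pos sq by (intro exp_Q_second_ratio_le_1[of a]) auto
      show "5.7 \<le> x"
        by (rule x_ge[of _ 119]) (use N in \<open>auto simp: power2_eq_square\<close>)
    qed (simp_all add: eval_nat_numeral)
  qed
  then show ?thesis by (simp add: F_def)
qed

theorem theorem3p1:
  fixes n :: int
  assumes "n \<ge> 2"
  shows "g (n + 1) < f n + 110 / mu (n - 1) ^ 5"
proof -
  define b where "b = (pi / 6)\<^sup>2"
  have "3.14 / 6 \<le> pi / 6" "pi / 6 \<le> 3.1416 / 6"
    using pi_approx by auto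
  then have "(3.14 / 6)\<^sup>2 \<le> b" "b \<le> (3.1416 / 6)\<^sup>2"
    unfolding b_def by (intro power_mono; simp)+
  then have b: "b \<ge> 0.27387" "b \<le> 0.274157"
    by (simp_all add: power2_eq_square)
  have mu_sq: "(mu m)\<^sup>2 = b * (24 * real_of_int m - 1)" and mu_pos: "mu m > 0" if "m \<ge> 1" for m
    using that by (simp_all add: mu_def b_def power_mult_distrib power_divide)
  have "n = 2 \<or> 3 \<le> n \<and> n \<le> 5 \<or> 6 \<le> n"
    using assms by linarith
  then have N: "24 * real_of_int n - 25 = 23 \<or>
      47 \<le> 24 * real_of_int n - 25 \<and> 24 * real_of_int n - 25 \<le> 95 \<or> 119 \<le> 24 * real_of_int n - 25"
    by auto
  have "exp (mu n - 2 * mu (n + 1) + mu (n + 2)) * (Q 1 (mu n) * Q 1 (mu (n + 2)) / (Q (- 1) (mu (n + 1)))\<^sup>2) <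
      exp (mu (n - 1) - 2 * mu n + mu (n + 1)) *
        (Q (- 1) (mu (n - 1)) * Q (- 1) (mu (n + 1)) / (Q 1 (mu n))\<^sup>2) + 110 / mu (n - 1) ^ 5"
    by (rule four_square_roots_gap_less_110[OF b N])
      (use assms in \<open>simp_all add: mu_sq mu_pos algebra_simps\<close>)
  then show ?thesis
    unfolding f_eq_Q g_eq_Q by (simp add: add.commute)
qed

end
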